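(* There exists an absolute constant $c>0$ such that for every integer $N\ge 2$ and all complex numbers $b_1,\dots,b_N$ satisfying $b_n=0$ whenever $n$ is not square-free, $$\int_0^1\left|\sum_{n=1}^N b_n e(n\alpha)\right|\,d\alpha\;\ge\;\frac{c}{N^{3/8}(\log N)^{1/2}}\left(\sum_{n=1}^N |b_n|^2\right)^{1/2}.$$
   Context: For real $x$, $e(x)=e^{2\pi i x}$. An integer $n\ge1$ is square-free if it is not divisible by $p^2$ for any prime $p$. *)

theory Defs
  imports "HOL-Analysis.Analysis" "HOL-Computational_Algebra.Squarefree"
begin

definition ee :: "real \<Rightarrow> complex" where
  "ee x = exp (2 * complex_of_real pi * \<i> * complex_of_real x)"

text \<open>
  The library's \<^const>\<open>squarefree\<close> quantifies over all square divisors; on the natural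
  numbers this is the same as having no divisor of the form \<open>p\<^sup>2\<close> with \<open>p\<close> prime.
\<close>

lemma squarefree_nat_iff_prime:
  fixes n :: nat
  assumes "n \<ge> 1"
  shows "squarefree n \<longleftrightarrow> (\<forall>p. prime p \<longrightarrow> \<not> p\<^sup>2 dvd n)"
  using assms by (intro squarefree_factorial_semiring) simp

end

theory Submission
  imports Defs "HOL-Number_Theory.Cong"
begin

text \<open>
  Let \<open>F\<close> be the exponential sum. For squarefree \<open>d\<close>, the vanishing of the coefficients at
  multiples of \<open>p\<^sup>2\<close> for the primes \<open>p\<close> dividing \<open>d\<close> gives
  \<open>|F(x)| \<le> \<Sum>|F(x + a/d\<^sup>2)|\<close>, the sum being over those \<open>a mod d\<^sup>2\<close> that no such \<open>p\<^sup>2\<close>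
  divides. If \<open>d \<le> N\<^bsup>1/4\<^esup>\<close>, all these points, for all \<open>d\<close>, are \<open>1/N\<close>-separated modulo 1, so
  adding up the inequalities over the \<open>\<ge> N\<^bsup>1/4\<^esup>/8\<close> squarefree \<open>d\<close> and applying the \<open>L\<^sup>1\<close> large sieve
  gives \<open>N\<^bsup>1/4\<^esup> sup |F| \<le> C N \<integral>|F|\<close>. The claim follows from
  \<open>\<Sum>|b\<^sub>n|\<^sup>2 = \<integral>|F|\<^sup>2 \<le> sup |F| \<integral>|F|\<close> and \<open>ln N \<ge> ln 2\<close>.
\<close>

section \<open>The character \<open>ee\<close>, orthogonality and elementary estimates\<close>

lemma ee_0 [simp]: "ee 0 = 1"
  by (simp add: ee_def)

lemma ee_add: "ee (x + y) = ee x * ee y"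
  by (simp add: ee_def exp_add [symmetric] algebra_simps)

lemma ee_conv_cis: "ee x = cis (2 * pi * x)"
  by (simp add: ee_def cis_conv_exp mult_ac)

lemma norm_ee [simp]: "cmod (ee x) = 1"
  by (simp add: ee_conv_cis)

lemma cnj_ee: "cnj (ee x) = ee (- x)"
  by (simp add: ee_conv_cis cis_cnj)

lemma ee_power: "ee x ^ k = ee (real k * x)"
  by (simp add: ee_conv_cis Complex.DeMoivre mult.left_commute)

lemma ee_of_int [simp]: "ee (of_int k) = 1"
  by (simp add: ee_conv_cis cis_multiple_2pi)

lemma ee_of_nat [simp]: "ee (of_nat k) = 1"
  using ee_of_int [of "int k"] by simp

lemma ee_eq_1_iff: "ee x = 1 \<longleftrightarrow> x \<in> \<int>"
  by (auto simp: ee_def exp_eq_1 Ints_def field_simps)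

lemma continuous_on_ee [continuous_intros]:
  "continuous_on A f \<Longrightarrow> continuous_on A (\<lambda>x. ee (f x))"
  unfolding ee_def by (intro continuous_intros)

lemma has_integral_ee_int:
  "((\<lambda>t. ee (of_int k * t)) has_integral (if k = 0 then 1 else 0)) {0..1}"
proof (cases "k = 0")
  case True
  then show ?thesis
    using has_integral_const_real [of "1 :: complex" 0 1] by simp
next
  case False
  define c where "c = 2 * complex_of_real pi * \<i> * of_int k"
  have ee_c: "ee (of_int k * t) = exp (c * of_real t)" for t
    by (simp add: ee_def c_def mult_ac)
  have "((\<lambda>z. exp (c * z) / c) has_field_derivative exp (c * z)) (at z)" for z
    using False by (auto simp: c_def intro!: derivative_eq_intros)
  then have "((\<lambda>t. exp (c * of_real t) / c) has_vector_derivative exp (c * of_real t)) (at t within {0..1})" for t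
    by (intro has_vector_derivative_real_field)
  then have "((\<lambda>t. ee (of_int k * t)) has_integral
          ee (of_int k * 1) / c - ee (of_int k * 0) / c) {0..1}"
    unfolding ee_c by (intro fundamental_theorem_of_calculus) auto
  then show ?thesis
    using False by simp
qed

text \<open>A full geometric sum whose ratio \<open>ee (n / q)\<close> is a \<open>q\<close>-th root
  of unity other than 1.\<close>

lemma sum_ee_residues:
  assumes "q > 0" and "\<not> q dvd n"
  shows "(\<Sum>v<q. ee (real n * (real v / real q))) = 0"
proof -
  let ?z = "ee (real n / real q)"
  have "?z \<noteq> 1"
  proof
    assume "?z = 1"
    then obtain k where "real n / real q = of_int k"
      by (auto simp: ee_eq_1_iff elim: Ints_cases)
    then have "real_of_int (int n) = real_of_int (k * int q)"
      using assms by (simp add: field_simps)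
    then have "int n = k * int q"
      by linarith
    then have "int q dvd int n"
      by simp
    with assms show False
      by simp
  qed
  moreover have "?z ^ q = 1"
    using assms by (simp add: ee_power)
  ultimately have "(\<Sum>v<q. ?z ^ v) = 0"
    by (simp add: geometric_sum)
  then show ?thesis
    by (simp add: ee_power mult.commute)
qed

text \<open>On this interval x^2 <= 2.56 < 3, so the error |sin x - x| <= x^3 / 6 takes away at most
  half of x.\<close>

lemma sin_ge_half:
  fixes x :: real
  assumes "0 \<le> x" "x \<le> pi / 2"
  shows "x / 2 \<le> sin x"
proof -
  have "x \<le> 1.6"
    using assms pi_approx by simp
  then have "x * x \<le> 1.6 * 1.6"
    using assms by (intro mult_mono) auto
  then have "x * (x * x) \<le> x * 3"
    using assms by (intro mult_left_mono) auto
  moreover have "\<bar>sin x - x\<bar> \<le> x ^ 3 / 6"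
    using Maclaurin_sin_bound [of x 3] assms
    by (simp add: numeral_3_eq_3 lessThan_Suc sin_coeff_def fact_numeral)
  ultimately show ?thesis
    unfolding power3_eq_cube by linarith
qed

text \<open>The minimum is the distance from \<open>s\<close> to the nearest integer, and the right
  side is the chord length 2 |sin (pi r)| with r = \<open>frac s\<close>. As pi >= 2,
  \<open>sin_ge_half\<close> at pi r, or at pi (1 - r) for r beyond 1/2, suffices.\<close>

lemma norm_ee_minus_1_ge: "2 * min (frac s) (1 - frac s) \<le> cmod (ee s - 1)"
proof -
  define r where "r = frac s"
  have r: "0 \<le> r" "r < 1"
    by (simp_all add: r_def frac_lt_1)
  have "s = of_int \<lfloor>s\<rfloor> + r"
    by (simp add: r_def frac_def)
  then have "ee s = ee r"
    by (metis ee_add ee_of_int mult_1)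
  then have *: "cmod (ee s - 1) = 2 * \<bar>sin (pi * r)\<bar>"
    using dist_exp_i_1 [of "2 * pi * r"] by (simp add: ee_def mult_ac)
  have "min r (1 - r) \<le> sin (pi * r)"
  proof (cases "r \<le> 1 / 2")
    case True
    then have "pi * r / 2 \<le> sin (pi * r)"
      using r by (intro sin_ge_half) auto
    moreover have "2 * r \<le> pi * r"
      using r pi_ge_two by (intro mult_right_mono) auto
    ultimately show ?thesis
      by simp
  next
    case False
    then have "pi * (1 - r) / 2 \<le> sin (pi * (1 - r))"
      using r by (intro sin_ge_half) auto
    moreover have "sin (pi * (1 - r)) = sin (pi * r)"
      by (simp add: right_diff_distrib sin_diff)
    moreover have "2 * (1 - r) \<le> pi * (1 - r)"
      using r pi_ge_two by (intro mult_right_mono) auto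
    ultimately show ?thesis
      by simp
  qed
  then show ?thesis
    using * by (simp add: r_def [symmetric])
qed

text \<open>Used both for the decay of the kernel and for counting squarefree numbers. For the
  latter the bound has to be below 2: without its first term the sum must stay below 1.\<close>

lemma sum_inverse_squares_le: "(\<Sum>j<n. 1 / (real j + 1)\<^sup>2) \<le> 7 / 4"
proof -
  have "(\<Sum>j<n. 1 / (real j + 1)\<^sup>2) \<le> pi\<^sup>2 / 6"
    using sum_le_suminf [of "\<lambda>j. 1 / (real j + 1)\<^sup>2" "{..<n}"] inverse_squares_sums
    by (auto simp: sums_iff add_ac)
  also have "pi\<^sup>2 \<le> 3.2\<^sup>2"
    using pi_approx pi_ge_zero by (intro power_mono) auto
  finally show ?thesis
    by (simp add: power2_eq_square) 
qed

section \<open>Dirichlet sums and the reproducing kernel\<close>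

definition dirichlet_sum :: "nat \<Rightarrow> real \<Rightarrow> complex" where
  "dirichlet_sum M s = (\<Sum>k<M. ee (real k * s))"

lemma norm_dirichlet_sum_le: "cmod (dirichlet_sum M s) \<le> real M"
proof -
  have "cmod (dirichlet_sum M s) \<le> (\<Sum>k<M. cmod (ee (real k * s)))"
    unfolding dirichlet_sum_def by (rule norm_sum)
  then show ?thesis
    by simp
qed

text \<open>The geometric sum times \<open>ee s - 1\<close> telescopes to a difference of two
  numbers of modulus 1. The product form also covers integral \<open>s\<close>.\<close>

lemma norm_dirichlet_sum_mult_le: "cmod (dirichlet_sum M s) * cmod (ee s - 1) \<le> 2"
proof -
  have "dirichlet_sum M s * (ee s - 1) = ee s ^ M - 1"
    unfolding dirichlet_sum_def
    unfolding ee_power [symmetric] by (subst power_diff_1_eq) (rule mult.commute)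
  then have "cmod (dirichlet_sum M s) * cmod (ee s - 1) = cmod (ee s ^ M - 1)"
    by (metis norm_mult)
  also have "\<dots> \<le> cmod (ee s ^ M) + cmod 1"
    by (rule norm_triangle_ineq4)
  finally show ?thesis
    by (simp add: norm_power)
qed

text \<open>
  A de la Vallee Poussin kernel: it reproduces frequencies \<open>0, \<dots>, N\<close>, and as a product of two
  Dirichlet kernels it decays quadratically.
\<close>

definition dvp_kernel :: "nat \<Rightarrow> real \<Rightarrow> complex" where
  "dvp_kernel N s = cnj (dirichlet_sum N s) * dirichlet_sum (2 * N) s / of_nat N"

lemma continuous_on_dvp_kernel [continuous_intros]:
  "continuous_on A f \<Longrightarrow> continuous_on A (\<lambda>t. dvp_kernel N (f t))"
  unfolding dvp_kernel_def dirichlet_sum_def divide_inverse by (intro continuous_intros)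

text \<open>The \<open>n\<close>-th Fourier coefficient of the kernel is 1/N times the number of
  pairs k < N, m < 2N with m - k = n. For n <= N every k < N contributes exactly one pair, since n +
  k < 2N, so the coefficient is 1.\<close>

lemma has_integral_dvp_kernel:
  assumes "n \<le> N" and "N > 0"
  shows "((\<lambda>t. ee (real n * t) * dvp_kernel N (x - t)) has_integral ee (real n * x)) {0..1}"
proof -
  have expand: "ee (real n * t) * dvp_kernel N (x - t) =
      (\<Sum>k<N. \<Sum>m<2*N. ee (real_of_int (int m - int k) * x) / of_nat N
          * ee (real_of_int (int n - int m + int k) * t))" for t
  proof -
    have "ee (real_of_int (int m - int k) * x) * ee (real_of_int (int n - int m + int k) * t)
        = ee (real n * t) * (cnj (ee (real k * (x - t))) * ee (real m * (x - t)))" for k m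
      by (simp add: cnj_ee ee_add [symmetric] algebra_simps)
    then show ?thesis
      unfolding dvp_kernel_def dirichlet_sum_def cnj_sum sum_product
      by (simp add: sum_distrib_left sum_divide_distrib)
  qed
  have "((\<lambda>t. ee (real n * t) * dvp_kernel N (x - t)) has_integral
      (\<Sum>k<N. \<Sum>m<2*N. ee (real_of_int (int m - int k) * x) / of_nat N
          * (if int n - int m + int k = 0 then 1 else 0))) {0..1}"
    unfolding expand
    by (intro has_integral_sum has_integral_mult_right has_integral_ee_int) auto
  also have "(\<Sum>k<N. \<Sum>m<2*N. ee (real_of_int (int m - int k) * x) / of_nat N
          * (if int n - int m + int k = 0 then 1 else 0)) = (\<Sum>k<N. ee (real n * x) / of_nat N)"
  proof (rule sum.cong)
    fix k assume "k \<in> {..<N}"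
    have "(\<Sum>m<2*N. ee (real_of_int (int m - int k) * x) / of_nat N
          * (if int n - int m + int k = 0 then 1 else 0))
        = (\<Sum>m<2*N. if m = n + k then ee (real n * x) / of_nat N else 0)"
      by (intro sum.cong) auto
    also have "\<dots> = ee (real n * x) / of_nat N"
      using \<open>k \<in> {..<N}\<close> assms by (subst sum.delta) auto
    finally show "(\<Sum>m<2*N. ee (real_of_int (int m - int k) * x) / of_nat N
          * (if int n - int m + int k = 0 then 1 else 0)) = ee (real n * x) / of_nat N" .
  qed simp
  also have "\<dots> = ee (real n * x)"
    using assms by simp
  finally show ?thesis .
qed

text \<open>\<open>k\<close> is the index of the arc of length 1/N that contains
  \<open>frac s\<close>, and \<open>N - Suc k\<close> is this index counted from the other end. On
  the two arcs next to the integers the trivial bound is used; elsewhere |e(s) - 1| controls both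
  Dirichlet factors. Adding the two terms, one for each end, prepares for summation over all
  arcs.\<close>

lemma norm_dvp_kernel_le:
  assumes "N > 0" and k: "k = nat \<lfloor>real N * frac s\<rfloor>"
  shows "k < N"
    and "cmod (dvp_kernel N s) \<le> 4 * real N * (1 / (real k + 1)\<^sup>2 + 1 / (real (N - Suc k) + 1)\<^sup>2)"
proof -
  define r where "r = frac s"
  have r: "0 \<le> r" "r < 1"
    by (simp_all add: r_def frac_lt_1)
  have kr: "real k \<le> real N * r" "real N * r < real k + 1"
    using r unfolding k r_def [symmetric] by (auto simp: of_nat_nat)
  moreover have "real N * r < real N * 1"
    using r assms by (intro mult_strict_left_mono) auto
  ultimately show "k < N"
    by linarith
  define j where "j = min k (N - Suc k)"
  have j: "real j \<le> real N * min r (1 - r)"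
  proof (cases "r \<le> 1 - r")
    case True
    then show ?thesis using kr by (simp add: j_def min_def)
  next
    case False
    have "real (N - Suc k) = real N - real k - 1"
      using \<open>k < N\<close> by (simp add: of_nat_diff)
    then show ?thesis using kr False by (simp add: j_def min_def algebra_simps)
  qed
  let ?D = "cmod (dirichlet_sum N s)" and ?E = "cmod (dirichlet_sum (2 * N) s)"
  have V: "cmod (dvp_kernel N s) = ?D * ?E / real N"
    by (simp add: dvp_kernel_def norm_mult norm_divide)
  have "cmod (dvp_kernel N s) \<le> 4 * real N / (real j + 1)\<^sup>2"
  proof (cases "j = 0")
    case True
    have "?D * ?E \<le> real N * real (2 * N)"
      by (intro mult_mono norm_dirichlet_sum_le) auto
    then have "?D * ?E / real N \<le> 2 * real N"
      using assms by (simp add: field_simps)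
    then show ?thesis
      using True V by simp
  next
    case False
    let ?w = "cmod (ee s - 1)"
    have w: "2 * real j / real N \<le> ?w"
    proof -
      have "2 * real j \<le> real N * (2 * min r (1 - r))"
        using j by simp
      also have "\<dots> \<le> real N * ?w"
        unfolding r_def by (intro mult_left_mono norm_ee_minus_1_ge) auto
      finally show ?thesis
        using assms by (simp add: field_simps)
    qed
    \<comment> \<open>As \<open>j\<close> is at least 1, j + 1 <= 2 j; this gives the far arcs a
      bound of the same shape as that for \<open>j = 0\<close>.\<close>
    have "(real j + 1) * (1 / real N) \<le> ?w"
      using w False divide_right_mono [of "real j + 1" "2 * real j" "real N"] by simp
    then have "((real j + 1) * (1 / real N)) * ((real j + 1) * (1 / real N)) \<le> ?w * ?w"
      by (intro mult_mono) auto
    then have "(?D * ?E) * (((real j + 1) * (1 / real N)) * ((real j + 1) * (1 / real N))) \<le> (?D * ?E) * (?w * ?w)"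
      by (intro mult_left_mono) auto
    also have "\<dots> = (?D * ?w) * (?E * ?w)"
      by simp
    also have "\<dots> \<le> 2 * 2"
      by (intro mult_mono norm_dirichlet_sum_mult_le) auto
    finally have "(?D * ?E) * (real j + 1)\<^sup>2 \<le> 4 * real N * real N"
      using assms by (simp add: power2_eq_square divide_le_eq)
    then have "?D * ?E \<le> 4 * real N * real N / (real j + 1)\<^sup>2"
      by (simp add: pos_le_divide_eq)
    then show ?thesis
      unfolding V using assms by (simp add: pos_divide_le_eq)
  qed
  also have "1 / (real j + 1)\<^sup>2 \<le> 1 / (real k + 1)\<^sup>2 + 1 / (real (N - Suc k) + 1)\<^sup>2"
    by (auto simp: j_def min_def)
  then have "4 * real N / (real j + 1)\<^sup>2 \<le> 4 * real N * (1 / (real k + 1)\<^sup>2 + 1 / (real (N - Suc k) + 1)\<^sup>2)"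
    using mult_left_mono [of _ _ "4 * real N"] by fastforce
  finally show "cmod (dvp_kernel N s) \<le> 4 * real N * (1 / (real k + 1)\<^sup>2 + 1 / (real (N - Suc k) + 1)\<^sup>2)" .
qed

text \<open>Letting \<open>k\<close> range over all integers makes the separation one modulo 1. The
  two ends of the circle contribute 7/4 each, whence 14 = 4 (7/4 + 7/4), uniformly in
  \<open>t\<close>.\<close>

lemma sum_norm_dvp_kernel_le:
  fixes x :: "'a \<Rightarrow> real"
  assumes "finite I" and "N > 0"
    and sep: "\<And>i j k. i \<in> I \<Longrightarrow> j \<in> I \<Longrightarrow> i \<noteq> j \<Longrightarrow> 1 / real N \<le> \<bar>x i - x j - of_int k\<bar>"
  shows "(\<Sum>i\<in>I. cmod (dvp_kernel N (x i - t))) \<le> 14 * real N"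
proof -
  define bin where "bin i = nat \<lfloor>real N * frac (x i - t)\<rfloor>" for i
  define h where "h k = 4 * real N * (1 / (real k + 1)\<^sup>2 + 1 / (real (N - Suc k) + 1)\<^sup>2)" for k
  \<comment> \<open>Each of the \<open>N\<close> bins of length \<open>1/N\<close> around the circle contains at most one point.\<close>
  have "inj_on bin I"
  proof (rule inj_onI)
    fix i j assume ij: "i \<in> I" "j \<in> I" "bin i = bin j"
    have "\<bar>u - v\<bar> < 1" if "nat \<lfloor>u\<rfloor> = nat \<lfloor>v\<rfloor>" "u \<ge> 0" "v \<ge> 0" for u v :: real
      using that by linarith
    from this [OF ij(3) [unfolded bin_def]]
    have "\<bar>real N * frac (x i - t) - real N * frac (x j - t)\<bar> < 1"
      by simp
    then have "real N * \<bar>frac (x i - t) - frac (x j - t)\<bar> < 1"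
      by (simp add: right_diff_distrib [symmetric] abs_mult)
    then have "\<bar>frac (x i - t) - frac (x j - t)\<bar> < 1 / real N"
      using assms by (simp add: field_simps)
    moreover have "frac (x i - t) - frac (x j - t) = x i - x j - of_int (\<lfloor>x i - t\<rfloor> - \<lfloor>x j - t\<rfloor>)"
      by (simp add: frac_def)
    ultimately show "i = j"
      using sep [OF ij(1,2), of "\<lfloor>x i - t\<rfloor> - \<lfloor>x j - t\<rfloor>"] by force
  qed
  have bin: "bin i < N" "cmod (dvp_kernel N (x i - t)) \<le> h (bin i)" for i
    unfolding h_def using norm_dvp_kernel_le [OF \<open>N > 0\<close> bin_def] by auto
  have "(\<Sum>i\<in>I. cmod (dvp_kernel N (x i - t))) \<le> (\<Sum>i\<in>I. h (bin i))"
    by (intro sum_mono bin)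
  also have "\<dots> = (\<Sum>k\<in>bin ` I. h k)"
    using \<open>inj_on bin I\<close> by (simp add: sum.reindex)
  also have "\<dots> \<le> (\<Sum>k<N. h k)"
    using bin by (intro sum_mono2) (auto simp: h_def)
  also have "\<dots> = 4 * real N * ((\<Sum>k<N. 1 / (real k + 1)\<^sup>2) + (\<Sum>k<N. 1 / (real (N - Suc k) + 1)\<^sup>2))"
    by (simp add: h_def sum_distrib_left [symmetric] sum.distrib)
  also have "(\<Sum>k<N. 1 / (real (N - Suc k) + 1)\<^sup>2) = (\<Sum>k<N. 1 / (real k + 1)\<^sup>2)"
    by (rule sum.nat_diff_reindex)
  also have "4 * real N * ((\<Sum>k<N. 1 / (real k + 1)\<^sup>2) + (\<Sum>k<N. 1 / (real k + 1)\<^sup>2))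
      \<le> 4 * real N * (7 / 4 + 7 / 4)"
    by (intro mult_left_mono add_mono sum_inverse_squares_le) auto
  finally show ?thesis
    by simp
qed

section \<open>Trigonometric polynomials: the large sieve and Parseval's identity\<close>

definition trig_poly :: "nat \<Rightarrow> (nat \<Rightarrow> complex) \<Rightarrow> real \<Rightarrow> complex" where
  "trig_poly N b x = (\<Sum>n=1..N. b n * ee (real n * x))"

lemma continuous_on_trig_poly [continuous_intros]:
  "continuous_on A f \<Longrightarrow> continuous_on A (\<lambda>x. trig_poly N b (f x))"
  unfolding trig_poly_def by (intro continuous_intros)

lemma trig_poly_add_of_int: "trig_poly N b (x + of_int k) = trig_poly N b x"
proof -
  have "ee (real n * (x + of_int k)) = ee (real n * x)" for n
    using ee_of_int [of "int n * k"] by (simp add: distrib_left ee_add)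
  then show ?thesis
    by (simp add: trig_poly_def)
qed

lemma has_integral_trig_poly_dvp_kernel:
  assumes "N > 0"
  shows "((\<lambda>t. trig_poly N b t * dvp_kernel N (x - t)) has_integral trig_poly N b x) {0..1}"
proof -
  have "((\<lambda>t. \<Sum>n=1..N. b n * (ee (real n * t) * dvp_kernel N (x - t))) has_integral trig_poly N b x) {0..1}"
    unfolding trig_poly_def
    using assms by (intro has_integral_sum has_integral_mult_right has_integral_dvp_kernel) auto
  then show ?thesis
    by (simp add: trig_poly_def sum_distrib_right mult.assoc)
qed

text \<open>Convolution with the kernel reproduces F, so |F(x i)| is at most the integral of |F|
  against the modulus of the kernel centred at x i. Summing over i under the integral leaves the
  kernel sum just bounded, at every t.\<close>

lemma large_sieve_L1:
  fixes x :: "'a \<Rightarrow> real"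
  assumes "finite I" and "N > 0"
    and sep: "\<And>i j k. i \<in> I \<Longrightarrow> j \<in> I \<Longrightarrow> i \<noteq> j \<Longrightarrow> 1 / real N \<le> \<bar>x i - x j - of_int k\<bar>"
  shows "(\<Sum>i\<in>I. cmod (trig_poly N b (x i))) \<le> 14 * real N * integral {0..1} (\<lambda>t. cmod (trig_poly N b t))"
proof -
  let ?F = "trig_poly N b"
  have "cmod (?F (x i)) \<le> integral {0..1} (\<lambda>t. cmod (?F t) * cmod (dvp_kernel N (x i - t)))" for i
  proof -
    have "cmod (integral {0..1} (\<lambda>t. ?F t * dvp_kernel N (x i - t)))
        \<le> integral {0..1} (\<lambda>t. cmod (?F t) * cmod (dvp_kernel N (x i - t)))"
      by (intro integral_norm_bound_integral integrable_continuous_real continuous_intros)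
         (simp add: norm_mult)
    then show ?thesis
      using has_integral_trig_poly_dvp_kernel [OF assms(2), of b "x i"]
      by (simp add: integral_unique)
  qed
  then have "(\<Sum>i\<in>I. cmod (?F (x i)))
      \<le> (\<Sum>i\<in>I. integral {0..1} (\<lambda>t. cmod (?F t) * cmod (dvp_kernel N (x i - t))))"
    by (intro sum_mono)
  also have "\<dots> = integral {0..1} (\<lambda>t. \<Sum>i\<in>I. cmod (?F t) * cmod (dvp_kernel N (x i - t)))"
    using assms by (intro integral_sum [symmetric] integrable_continuous_real continuous_intros) auto
  also have "\<dots> \<le> integral {0..1} (\<lambda>t. 14 * real N * cmod (?F t))"
  proof (intro integral_le integrable_continuous_real continuous_intros)
    fix t :: real
    have "cmod (?F t) * (\<Sum>i\<in>I. cmod (dvp_kernel N (x i - t))) \<le> cmod (?F t) * (14 * real N)"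
      using sum_norm_dvp_kernel_le [OF assms] by (intro mult_left_mono) auto
    then show "(\<Sum>i\<in>I. cmod (?F t) * cmod (dvp_kernel N (x i - t))) \<le> 14 * real N * cmod (?F t)"
      by (simp add: sum_distrib_left mult_ac)
  qed
  finally show ?thesis
    by simp
qed

text \<open>By Parseval, proved here from orthogonality, the left side is the integral of F times
  its conjugate; one of the two factors is bounded by \<open>B\<close>.\<close>

lemma sum_norm_squared_le:
  assumes "\<And>x. cmod (trig_poly N b x) \<le> B"
  shows "(\<Sum>n=1..N. (cmod (b n))\<^sup>2) \<le> B * integral {0..1} (\<lambda>x. cmod (trig_poly N b x))"
proof -
  let ?F = "trig_poly N b"
  have coeff: "((\<lambda>t. ?F t * ee (- (real m * t))) has_integral b m) {0..1}" if "m \<in> {1..N}" for m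
  proof -
    have "((\<lambda>t. \<Sum>n=1..N. b n * ee (of_int (int n - int m) * t)) has_integral
            (\<Sum>n=1..N. b n * (if int n - int m = 0 then 1 else 0))) {0..1}"
      by (intro has_integral_sum has_integral_mult_right has_integral_ee_int) auto
    also have "ee (of_int (int n - int m) * t) = ee (real n * t) * ee (- (real m * t))" for n t
      by (simp add: ee_add [symmetric] algebra_simps)
    then have "(\<lambda>t. \<Sum>n=1..N. b n * ee (of_int (int n - int m) * t)) = (\<lambda>t. ?F t * ee (- (real m * t)))"
      unfolding trig_poly_def sum_distrib_right mult.assoc by simp
    also have "(\<Sum>n=1..N. b n * (if int n - int m = 0 then 1 else 0)) = (\<Sum>n=1..N. if n = m then b n else 0)"
      by (intro sum.cong) auto
    also have "\<dots> = b m"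
      using that by (subst sum.delta) auto
    finally show ?thesis .
  qed
  have "((\<lambda>t. \<Sum>n=1..N. cnj (b n) * (?F t * ee (- (real n * t)))) has_integral (\<Sum>n=1..N. cnj (b n) * b n)) {0..1}"
    by (intro has_integral_sum has_integral_mult_right coeff) auto
  moreover have "(\<Sum>n=1..N. cnj (b n) * (?F t * ee (- (real n * t)))) = ?F t * cnj (?F t)" for t
    by (simp add: trig_poly_def [of N b t] sum_distrib_left cnj_ee mult_ac)
  moreover have "(\<Sum>n=1..N. cnj (b n) * b n) = of_real (\<Sum>n=1..N. (cmod (b n))\<^sup>2)"
    by (simp add: complex_norm_square mult.commute del: of_real_power)
  ultimately have "integral {0..1} (\<lambda>t. ?F t * cnj (?F t)) = of_real (\<Sum>n=1..N. (cmod (b n))\<^sup>2)"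
    by (simp add: integral_unique)
  then have "(\<Sum>n=1..N. (cmod (b n))\<^sup>2) = cmod (integral {0..1} (\<lambda>t. ?F t * cnj (?F t)))"
    by (simp add: sum_nonneg del: of_real_sum)
  also have "\<dots> \<le> integral {0..1} (\<lambda>t. B * cmod (?F t))"
    using assms
    by (intro integral_norm_bound_integral integrable_continuous_real continuous_intros)
       (auto simp: norm_mult intro!: mult_right_mono)
  finally show ?thesis
    by simp
qed

section \<open>Bounding F by its translates\<close>

text \<open>For squarefree \<open>d\<close> these are, by the Chinese remainder theorem, the
  numerators modulo d^2 of sums of fractions v / p^2, one for each prime p dividing d, with v
  nonzero modulo p^2. They need not be coprime to \<open>d\<close>: a single factor p is
  allowed.\<close>

definition square_residues :: "nat \<Rightarrow> nat set" where
  "square_residues d = {a. a < d\<^sup>2 \<and> (\<forall>p. prime p \<longrightarrow> p dvd d \<longrightarrow> \<not> p\<^sup>2 dvd a)}"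

lemma finite_square_residues [simp]: "finite (square_residues d)"
  unfolding square_residues_def by simp

lemma square_residues_1: "square_residues 1 = {0}"
  unfolding square_residues_def by (auto dest: not_prime_unit)

text \<open>Summing over all translates by multiples of 1/p^2 keeps only the frequencies divisible
  by p^2, whose coefficients are 0.\<close>

lemma sum_trig_poly_prime_square:
  assumes "prime p" and "\<And>n. n \<in> {1..N} \<Longrightarrow> p\<^sup>2 dvd n \<Longrightarrow> b n = 0"
  shows "(\<Sum>v<p\<^sup>2. trig_poly N b (x + real v / real (p\<^sup>2))) = 0"
proof -
  have "p\<^sup>2 > 0"
    using assms(1) prime_gt_0_nat by simp
  have "(\<Sum>v<p\<^sup>2. trig_poly N b (x + real v / real (p\<^sup>2)))
      = (\<Sum>n=1..N. b n * ee (real n * x) * (\<Sum>v<p\<^sup>2. ee (real n * (real v / real (p\<^sup>2)))))"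
    unfolding trig_poly_def distrib_left ee_add
    by (subst sum.swap) (simp add: sum_distrib_left mult.assoc)
  also have "\<dots> = 0"
    using assms(2) sum_ee_residues [OF \<open>p\<^sup>2 > 0\<close>] by (intro sum.neutral) fastforce
  finally show ?thesis .
qed

lemma norm_trig_poly_le_prime_square:
  assumes "prime p" and "\<And>n. n \<in> {1..N} \<Longrightarrow> p\<^sup>2 dvd n \<Longrightarrow> b n = 0"
  shows "cmod (trig_poly N b x) \<le> (\<Sum>v\<in>{0<..<p\<^sup>2}. cmod (trig_poly N b (x + real v / real (p\<^sup>2))))"
proof -
  have "{..<p\<^sup>2} = insert 0 {0<..<p\<^sup>2}"
    using assms(1) prime_gt_0_nat by auto
  then have "trig_poly N b x + (\<Sum>v\<in>{0<..<p\<^sup>2}. trig_poly N b (x + real v / real (p\<^sup>2))) = 0"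
    using sum_trig_poly_prime_square [where x = x, OF assms] by simp
  then have "cmod (trig_poly N b x) = cmod (\<Sum>v\<in>{0<..<p\<^sup>2}. trig_poly N b (x + real v / real (p\<^sup>2)))"
    by (metis add_eq_0_iff norm_minus_cancel)
  also have "\<dots> \<le> (\<Sum>v\<in>{0<..<p\<^sup>2}. cmod (trig_poly N b (x + real v / real (p\<^sup>2))))"
    by (rule norm_sum)
  finally show ?thesis .
qed

text \<open>The Chinese remainder map: \<open>f (v, a)\<close> is v e^2 modulo p^2 and a p^2 modulo
  e^2, where e^2 and p^2 are units for the respective moduli. The condition at \<open>p\<close> thus
  comes from \<open>v\<close> being nonzero modulo p^2, and those at the primes of \<open>e\<close>
  come from \<open>a\<close>.\<close>

lemma square_residues_mult_prime:
  assumes "prime p" and "\<not> p dvd e" and "e > 0"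
    and f: "f = (\<lambda>(v, a). (v * e\<^sup>2 + a * p\<^sup>2) mod (p * e)\<^sup>2)"
  shows "inj_on f ({0<..<p\<^sup>2} \<times> square_residues e)"
    and "f ` ({0<..<p\<^sup>2} \<times> square_residues e) \<subseteq> square_residues (p * e)"
proof -
  have "p > 0"
    using assms(1) by (rule prime_gt_0_nat)
  have coprime: "coprime (p\<^sup>2) (e\<^sup>2)"
    using assms by (simp add: prime_imp_coprime)
  have cong_f: "[f (v, a) = v * e\<^sup>2 + a * p\<^sup>2] (mod (p * e)\<^sup>2)" for v a
    by (simp add: f cong_def)
  have cong_p: "[f (v, a) = v * e\<^sup>2] (mod p\<^sup>2)" for v a
  proof -
    have "[f (v, a) = v * e\<^sup>2 + a * p\<^sup>2] (mod p\<^sup>2)"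
      using cong_f by (rule cong_dvd_modulus_nat) (simp add: power_mult_distrib)
    then show ?thesis
      by (simp add: cong_def)
  qed
  have cong_e: "[f (v, a) = a * p\<^sup>2] (mod e\<^sup>2)" for v a
  proof -
    have "[f (v, a) = v * e\<^sup>2 + a * p\<^sup>2] (mod e\<^sup>2)"
      using cong_f by (rule cong_dvd_modulus_nat) (simp add: power_mult_distrib)
    then show ?thesis
      by (simp add: cong_def)
  qed
  show "inj_on f ({0<..<p\<^sup>2} \<times> square_residues e)"
  proof (rule inj_onI, clarify)
    fix v a v' a'
    assume v: "v \<in> {0<..<p\<^sup>2}" "v' \<in> {0<..<p\<^sup>2}" and a: "a \<in> square_residues e" "a' \<in> square_residues e"
      and eq: "f (v, a) = f (v', a')"
    have "[v * e\<^sup>2 = v' * e\<^sup>2] (mod p\<^sup>2)"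
      using cong_p [of v a] cong_p [of v' a'] eq by (simp add: cong_def)
    then have "[v = v'] (mod p\<^sup>2)"
      using coprime by (simp add: cong_mult_rcancel_nat coprime_commute)
    moreover have "[a * p\<^sup>2 = a' * p\<^sup>2] (mod e\<^sup>2)"
      using cong_e [of v a] cong_e [of v' a'] eq by (simp add: cong_def)
    then have "[a = a'] (mod e\<^sup>2)"
      using coprime by (simp add: cong_mult_rcancel_nat coprime_commute)
    ultimately show "v = v' \<and> a = a'"
      using v a by (auto simp: cong_def square_residues_def)
  qed
  show "f ` ({0<..<p\<^sup>2} \<times> square_residues e) \<subseteq> square_residues (p * e)"
  proof clarify
    fix v a assume v: "v \<in> {0<..<p\<^sup>2}" and a: "a \<in> square_residues e"
    have "f (v, a) < (p * e)\<^sup>2"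
      using \<open>p > 0\<close> \<open>e > 0\<close> by (simp add: f)
    moreover have "\<not> q\<^sup>2 dvd f (v, a)" if q: "prime q" "q dvd p * e" for q
    proof
      assume dvd: "q\<^sup>2 dvd f (v, a)"
      show False
      proof (cases "q = p")
        case True
        then have "p\<^sup>2 dvd v * e\<^sup>2"
          using dvd cong_dvd_iff [OF cong_p] by simp
        then have "p\<^sup>2 dvd v"
          using coprime by (simp add: coprime_dvd_mult_left_iff)
        then show False
          using v by (auto dest: dvd_imp_le)
      next
        case False
        then have "q dvd e"
          using q assms(1) by (metis prime_dvd_mult_iff primes_dvd_imp_eq)
        then have "[f (v, a) = a * p\<^sup>2] (mod q\<^sup>2)"
          using cong_e by (rule_tac cong_dvd_modulus_nat) (auto simp: dvd_power_same)
        then have "q\<^sup>2 dvd a * p\<^sup>2"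
          using dvd cong_dvd_iff by blast
        moreover have "coprime (q\<^sup>2) (p\<^sup>2)"
          using q assms(1) False by (simp add: primes_coprime)
        ultimately have "q\<^sup>2 dvd a"
          by (simp add: coprime_dvd_mult_left_iff)
        then show False
          using a q \<open>q dvd e\<close> by (auto simp: square_residues_def)
      qed
    qed
    ultimately show "f (v, a) \<in> square_residues (p * e)"
      by (simp add: square_residues_def)
  qed
qed

text \<open>Induction on \<open>d\<close>, splitting off one prime: the inequality for p^2 is
  applied at \<open>x\<close>, then the induction hypothesis for the cofactor at each translate,
  which is why \<open>x\<close> must be arbitrary.\<close>

lemma norm_trig_poly_le_squarefree:
  assumes "\<And>n. n \<in> {1..N} \<Longrightarrow> \<not> squarefree n \<Longrightarrow> b n = 0" and "squarefree d"
  shows "cmod (trig_poly N b x) \<le> (\<Sum>a\<in>square_residues d. cmod (trig_poly N b (x + real a / real (d\<^sup>2))))"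
  using assms(2)
proof (induction d arbitrary: x rule: less_induct)
  case (less d)
  show ?case
  proof (cases "d = 1")
    case True
    then show ?thesis
      unfolding True square_residues_1 by simp
  next
    case False
    then obtain p where p: "prime p" "p dvd d"
      using prime_factor_nat by blast
    then obtain e where e: "d = p * e"
      by (auto elim: dvdE)
    have "d > 0"
      using less.prems by (metis gr0I not_squarefree_0)
    then have "e > 0"
      using e by simp
    have "p > 1"
      using p(1) by (rule prime_gt_1_nat)
    have "e < d"
      using e \<open>p > 1\<close> \<open>e > 0\<close> by simp
    have "\<not> p dvd e"
    proof
      assume "p dvd e"
      then have "p\<^sup>2 dvd d"
        by (simp add: e power2_eq_square)
      then show False
        using less.prems \<open>p > 1\<close> by (auto dest: squarefreeD)
    qed
    have "squarefree e"
      using less.prems e squarefree_multD by blast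
    \<comment> \<open>\<open>v/p\<^sup>2 + a/e\<^sup>2\<close> equals \<open>f (v, a) / d\<^sup>2\<close> modulo 1.\<close>
    define f where "f = (\<lambda>(v, a). (v * e\<^sup>2 + a * p\<^sup>2) mod (p * e)\<^sup>2)"
    note f = square_residues_mult_prime [OF p(1) \<open>\<not> p dvd e\<close> \<open>e > 0\<close> f_def]
    have shift: "trig_poly N b (x + real v / real (p\<^sup>2) + real a / real (e\<^sup>2))
        = trig_poly N b (x + real (f (v, a)) / real (d\<^sup>2))" for v a
    proof -
      define k where "k = (v * e\<^sup>2 + a * p\<^sup>2) div d\<^sup>2"
      have "v * e\<^sup>2 + a * p\<^sup>2 = f (v, a) + d\<^sup>2 * k"
        by (simp add: f_def k_def e)
      then have "real v * real (e\<^sup>2) + real a * real (p\<^sup>2) = real (f (v, a)) + real (d\<^sup>2) * real k"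
        by (metis of_nat_add of_nat_mult)
      moreover have "real (d\<^sup>2) = real (p\<^sup>2) * real (e\<^sup>2)"
        by (simp add: e power_mult_distrib)
      ultimately have "real v / real (p\<^sup>2) + real a / real (e\<^sup>2) = real (f (v, a)) / real (d\<^sup>2) + real k"
        using \<open>e > 0\<close> \<open>p > 1\<close> by (simp add: divide_simps)
      then show ?thesis
        using trig_poly_add_of_int [of N b "x + real (f (v, a)) / real (d\<^sup>2)" "int k"]
        by (simp add: add.assoc)
    qed
    have "cmod (trig_poly N b x) \<le> (\<Sum>v\<in>{0<..<p\<^sup>2}. cmod (trig_poly N b (x + real v / real (p\<^sup>2))))"
    proof (rule norm_trig_poly_le_prime_square [OF p(1)])
      show "b n = 0" if "n \<in> {1..N}" "p\<^sup>2 dvd n" for n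
        using that assms(1) \<open>p > 1\<close> not_squarefreeI [of p n] by auto
    qed
    also have "\<dots> \<le> (\<Sum>v\<in>{0<..<p\<^sup>2}. \<Sum>a\<in>square_residues e.
        cmod (trig_poly N b (x + real v / real (p\<^sup>2) + real a / real (e\<^sup>2))))"
      using less.IH [OF \<open>e < d\<close> \<open>squarefree e\<close>] by (intro sum_mono)
    also have "\<dots> = (\<Sum>z\<in>{0<..<p\<^sup>2} \<times> square_residues e. cmod (trig_poly N b (x + real (f z) / real (d\<^sup>2))))"
      unfolding shift sum.cartesian_product by (simp add: split_def)
    also have "\<dots> = (\<Sum>a\<in>f ` ({0<..<p\<^sup>2} \<times> square_residues e). cmod (trig_poly N b (x + real a / real (d\<^sup>2))))"
      using f(1) by (simp add: sum.reindex)
    also have "\<dots> \<le> (\<Sum>a\<in>square_residues d. cmod (trig_poly N b (x + real a / real (d\<^sup>2))))"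
      using f(2) e by (intro sum_mono2) auto
    finally show ?thesis .
  qed
qed

section \<open>Spacing of the points a / d^2 modulo 1\<close>

lemma squarefree_dvdI:
  fixes d e :: nat
  assumes "squarefree d" and "e > 0" and "\<And>p. prime p \<Longrightarrow> p dvd d \<Longrightarrow> p dvd e"
  shows "d dvd e"
proof -
  have "d \<noteq> 0"
    using assms(1) by (metis not_squarefree_0)
  have "multiplicity p d \<le> multiplicity p e" if "prime p" for p
  proof (cases "p dvd d")
    case True
    have "multiplicity p d \<le> 1"
      using assms(1) \<open>d \<noteq> 0\<close> that by (simp add: squarefree_factorial_semiring'')
    also have "1 \<le> multiplicity p e"
      using assms(2) assms(3) [OF that True] that
      by (intro multiplicity_geI) (auto simp: not_prime_unit)
    finally show ?thesis .
  qed (simp add: not_dvd_imp_multiplicity_0)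
  then show ?thesis
    using \<open>d \<noteq> 0\<close> assms(2) by (simp add: prime_multiplicity_le_imp_dvd)
qed

text \<open>If a prime p of \<open>d\<close> did not divide \<open>e\<close>, then p^2 would have to
  divide \<open>a\<close>, which \<open>square_residues\<close> forbids.\<close>

lemma square_residues_imp_dvd:
  assumes "squarefree d" and "e > 0" and "a \<in> square_residues d" and "d\<^sup>2 dvd a * e\<^sup>2"
  shows "d dvd e"
proof (rule squarefree_dvdI [OF assms(1,2)])
  fix p :: nat assume p: "prime p" "p dvd d"
  show "p dvd e"
  proof (rule ccontr)
    assume "\<not> p dvd e"
    then have "coprime (p\<^sup>2) (e\<^sup>2)"
      using p by (simp add: prime_imp_coprime)
    moreover have "p\<^sup>2 dvd a * e\<^sup>2"
      using p assms(4) by (meson dvd_power_same dvd_trans)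
    ultimately have "p\<^sup>2 dvd a"
      by (simp add: coprime_dvd_mult_left_iff)
    then show False
      using p assms(3) by (auto simp: square_residues_def)
  qed
qed

text \<open>The difference is an integer \<open>z\<close> over d^2 e^2, so it is enough that
  \<open>z\<close> is nonzero. If \<open>z\<close> were 0, then d and e would divide each other by
  \<open>square_residues_imp_dvd\<close>; with d = e, the numerators would be congruent modulo d^2
  and hence equal.\<close>

lemma square_residues_separated:
  assumes "squarefree d" "squarefree e" and "a \<in> square_residues d" "c \<in> square_residues e"
    and "(d, a) \<noteq> (e, c)"
  shows "1 / (real (d\<^sup>2) * real (e\<^sup>2)) \<le> \<bar>real a / real (d\<^sup>2) - real c / real (e\<^sup>2) - of_int k\<bar>"
proof -
  have pos: "d > 0" "e > 0"
    using assms by (auto intro!: Nat.gr0I)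
  define z where "z = int a * int (e\<^sup>2) - int c * int (d\<^sup>2) - k * int (d\<^sup>2) * int (e\<^sup>2)"
  have "z \<noteq> 0"
  proof
    assume "z = 0"
    then have eq: "int a * int (e\<^sup>2) = int (d\<^sup>2) * (int c + k * int (e\<^sup>2))"
      "int c * int (d\<^sup>2) = int (e\<^sup>2) * (int a - k * int (d\<^sup>2))"
      by (simp_all add: z_def algebra_simps)
    then have "int (d\<^sup>2) dvd int (a * e\<^sup>2)" "int (e\<^sup>2) dvd int (c * d\<^sup>2)"
      by simp_all
    then have dvd: "d\<^sup>2 dvd a * e\<^sup>2" "e\<^sup>2 dvd c * d\<^sup>2"
      by (simp_all only: int_dvd_int_iff)
    have "d dvd e" "e dvd d"
      using assms pos dvd by (auto intro: square_residues_imp_dvd)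
    then have "d = e"
      by (rule dvd_antisym)
    then have "int (d\<^sup>2) * int a = int (d\<^sup>2) * (int c + k * int (d\<^sup>2))"
      using eq(1) by (simp only: mult.commute)
    then have "int a - int c = k * int (d\<^sup>2)"
      using pos by simp
    then have "[int a = int c] (mod int (d\<^sup>2))"
      by (simp add: cong_iff_dvd_diff)
    then have "[a = c] (mod d\<^sup>2)"
      by (simp only: cong_int_iff)
    then have "a = c"
      using assms \<open>d = e\<close> by (simp add: cong_def square_residues_def)
    with \<open>d = e\<close> show False
      using assms by simp
  qed
  then have "1 \<le> \<bar>real_of_int z\<bar>"
    by linarith
  also have "real_of_int z = (real a / real (d\<^sup>2) - real c / real (e\<^sup>2) - of_int k) * (real (d\<^sup>2) * real (e\<^sup>2))"
    using pos by (simp add: z_def field_simps)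
  finally have "1 \<le> \<bar>real a / real (d\<^sup>2) - real c / real (e\<^sup>2) - of_int k\<bar> * (real (d\<^sup>2) * real (e\<^sup>2))"
    by (simp add: abs_mult)
  then show ?thesis
    using pos by (subst pos_divide_le_eq) auto
qed

section \<open>Counting squarefree numbers\<close>

text \<open>Union bound: every other number up to \<open>P\<close> is a multiple of some k^2 with k
  >= 2, and there are at most P / k^2 of these. The sum of 1/k^2 from k = 2 is at most 7/4 - 1 =
  3/4.\<close>

lemma card_squarefree_ge: "real P / 4 \<le> real (card {d \<in> {1..P}. squarefree d})"
proof -
  have "{1..P} - {d \<in> {1..P}. squarefree d} \<subseteq> (\<Union>k\<in>{2..P}. (\<lambda>j. k\<^sup>2 * j) ` {1..P div k\<^sup>2})"
  proof
    fix d assume d: "d \<in> {1..P} - {d \<in> {1..P}. squarefree d}"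
    then obtain k where k: "k\<^sup>2 dvd d" "k \<noteq> 1"
      by (auto elim: not_squarefreeE)
    then obtain j where j: "d = k\<^sup>2 * j"
      by (auto elim: dvdE)
    have "k \<noteq> 0"
      using d j by (cases "k = 0") auto
    have "j \<noteq> 0"
      using d j by (cases "j = 0") auto
    have "k \<le> k\<^sup>2"
      by (simp add: power2_eq_square)
    also have "k\<^sup>2 \<le> d"
      using \<open>j \<noteq> 0\<close> by (simp add: j)
    finally have "k \<in> {2..P}"
      using d k \<open>k \<noteq> 0\<close> by auto
    moreover have "j \<in> {1..P div k\<^sup>2}"
      using d j \<open>j \<noteq> 0\<close> \<open>k \<noteq> 0\<close> by (auto simp: less_eq_div_iff_mult_less_eq mult.commute)
    ultimately show "d \<in> (\<Union>k\<in>{2..P}. (\<lambda>j. k\<^sup>2 * j) ` {1..P div k\<^sup>2})"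
      using j by blast
  qed
  then have "card ({1..P} - {d \<in> {1..P}. squarefree d}) \<le> card (\<Union>k\<in>{2..P}. (\<lambda>j. k\<^sup>2 * j) ` {1..P div k\<^sup>2})"
    by (intro card_mono) auto
  also have "\<dots> \<le> (\<Sum>k\<in>{2..P}. card ((\<lambda>j. k\<^sup>2 * j) ` {1..P div k\<^sup>2}))"
    by (intro card_UN_le) auto
  also have "\<dots> \<le> (\<Sum>k\<in>{2..P}. P div k\<^sup>2)"
  proof (rule sum_mono)
    show "card ((\<lambda>j. k\<^sup>2 * j) ` {1..P div k\<^sup>2}) \<le> P div k\<^sup>2" for k
      using card_image_le [of "{1..P div k\<^sup>2}" "\<lambda>j. k\<^sup>2 * j"] by simp
  qed
  finally have "real (card ({1..P} - {d \<in> {1..P}. squarefree d})) \<le> (\<Sum>k\<in>{2..P}. real (P div k\<^sup>2))"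
    by (metis of_nat_le_iff of_nat_sum)
  also have "\<dots> \<le> (\<Sum>k\<in>{2..P}. real P * (1 / (real k)\<^sup>2))"
  proof (rule sum_mono)
    show "real (P div k\<^sup>2) \<le> real P * (1 / (real k)\<^sup>2)" for k
      using of_nat_div_le_of_nat [of P "k\<^sup>2", where ?'a = real] by simp
  qed
  also have "\<dots> = real P * (\<Sum>k\<in>{2..P}. 1 / (real k)\<^sup>2)"
    by (simp add: sum_distrib_left)
  also have "(\<Sum>k\<in>{2..P}. 1 / (real k)\<^sup>2) \<le> 3 / 4"
  proof (cases "P = 0")
    case False
    then have "(\<Sum>k\<in>{2..P}. 1 / (real k)\<^sup>2) = (\<Sum>k\<in>{1..P}. 1 / (real k)\<^sup>2) - 1"
      by (subst (2) sum.atLeast_Suc_atMost) (auto simp: numeral_2_eq_2)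
    also have "(\<Sum>k\<in>{1..P}. 1 / (real k)\<^sup>2) = (\<Sum>j<P. 1 / (real j + 1)\<^sup>2)"
      by (rule sum.reindex_bij_witness [of _ Suc "\<lambda>k. k - 1"]) auto
    finally show ?thesis
      using sum_inverse_squares_le [of P] by simp
  qed simp
  then have "real P * (\<Sum>k\<in>{2..P}. 1 / (real k)\<^sup>2) \<le> real P * (3 / 4)"
    by (intro mult_left_mono) auto
  finally have "real (card ({1..P} - {d \<in> {1..P}. squarefree d})) \<le> real P * (3 / 4)" .
  moreover have "card ({1..P} - {d \<in> {1..P}. squarefree d}) = P - card {d \<in> {1..P}. squarefree d}"
    by (subst card_Diff_subset) auto
  moreover have "card {d \<in> {1..P}. squarefree d} \<le> P"
    by (rule order_trans [OF card_mono [of "{1..P}"]]) auto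
  ultimately show ?thesis
    by (simp add: of_nat_diff)
qed

section \<open>Combining the inequalities\<close>

lemma card_squarefree_mult_norm_trig_poly_le:
  assumes "N > 0" and "P ^ 4 \<le> N" and "\<And>n. n \<in> {1..N} \<Longrightarrow> \<not> squarefree n \<Longrightarrow> b n = 0"
  shows "real (card {d \<in> {1..P}. squarefree d}) * cmod (trig_poly N b x)
    \<le> 14 * real N * integral {0..1} (\<lambda>t. cmod (trig_poly N b t))"
proof -
  define I where "I = Sigma {d \<in> {1..P}. squarefree d} square_residues"
  define pt where "pt = (\<lambda>(d, a). x + real a / real (d\<^sup>2))"
  have "real (card {d \<in> {1..P}. squarefree d}) * cmod (trig_poly N b x)
      = (\<Sum>d\<in>{d \<in> {1..P}. squarefree d}. cmod (trig_poly N b x))"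
    by simp
  also have "\<dots> \<le> (\<Sum>d\<in>{d \<in> {1..P}. squarefree d}. \<Sum>a\<in>square_residues d.
      cmod (trig_poly N b (x + real a / real (d\<^sup>2))))"
    using assms(3) by (intro sum_mono norm_trig_poly_le_squarefree) auto
  also have "\<dots> = (\<Sum>i\<in>I. cmod (trig_poly N b (pt i)))"
    by (simp add: I_def pt_def sum.Sigma split_def)
  also have "\<dots> \<le> 14 * real N * integral {0..1} (\<lambda>t. cmod (trig_poly N b t))"
  proof (rule large_sieve_L1)
    show "finite I"
      by (simp add: I_def)
    fix i j k assume ij: "i \<in> I" "j \<in> I" "i \<noteq> j"
    obtain d a e c where de: "i = (d, a)" "j = (e, c)"
      by (metis surj_pair)
    \<comment> \<open>Here \<open>P ^ 4 <= N\<close> enters: points belonging to any two moduli up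
      to \<open>P\<close> are at least 1 / P^4 >= 1/N apart. The common shift by \<open>x\<close>
      cancels.\<close>
    have "d\<^sup>2 * e\<^sup>2 \<le> P\<^sup>2 * P\<^sup>2"
      using ij by (intro mult_mono power_mono) (auto simp: I_def de)
    also have "\<dots> = P ^ 4"
      by (simp add: power_add [symmetric])
    also have "\<dots> \<le> N"
      by fact
    finally have "real (d\<^sup>2) * real (e\<^sup>2) \<le> real N"
      by (metis of_nat_le_iff of_nat_mult)
    moreover have "real (d\<^sup>2) * real (e\<^sup>2) > 0"
      using ij by (auto simp: I_def de)
    ultimately have "1 / real N \<le> 1 / (real (d\<^sup>2) * real (e\<^sup>2))"
      by (intro divide_left_mono) auto
    also have "\<dots> \<le> \<bar>real a / real (d\<^sup>2) - real c / real (e\<^sup>2) - of_int k\<bar>"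
      using ij by (intro square_residues_separated) (auto simp: I_def de)
    finally show "1 / real N \<le> \<bar>pt i - pt j - of_int k\<bar>"
      by (simp add: pt_def de)
  qed fact
  finally show ?thesis .
qed

lemma sum_norm_squared_le_L1_squared:
  assumes "N > 0" and "\<And>n. n \<in> {1..N} \<Longrightarrow> \<not> squarefree n \<Longrightarrow> b n = 0"
  shows "(\<Sum>n=1..N. (cmod (b n))\<^sup>2)
    \<le> 112 * real N powr (3/4) * (integral {0..1} (\<lambda>t. cmod (trig_poly N b t)))\<^sup>2"
proof -
  define J where "J = integral {0..1} (\<lambda>t. cmod (trig_poly N b t))"
  have "J \<ge> 0"
    unfolding J_def by (intro integral_nonneg integrable_continuous_real continuous_intros) auto
  define R where "R = real N powr (1/4)"
  define P where "P = nat \<lfloor>R\<rfloor>"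
  have "R \<ge> 1"
    using assms by (simp add: R_def ge_one_powr_ge_zero)
  have R4: "R ^ 4 = real N"
    using assms by (simp add: R_def powr_power)
  have P: "real P \<le> R" "R / 2 \<le> real P"
  proof -
    show "real P \<le> R"
      using \<open>R \<ge> 1\<close> unfolding P_def by linarith
    have "R - 1 < real P"
      unfolding P_def by linarith
    \<comment> \<open>From 1 <= P and R < P + 1 follows R < 2 P, so rounding down loses at most a
      factor 2.\<close>
    moreover have "1 \<le> P"
      using le_nat_floor [of 1 R] \<open>R \<ge> 1\<close> unfolding P_def by simp
    ultimately show "R / 2 \<le> real P"
      by linarith
  qed
  have "real (P ^ 4) \<le> R ^ 4"
    unfolding of_nat_power using P by (intro power_mono) auto
  then have "P ^ 4 \<le> N"
    using R4 by simp
  have "cmod (trig_poly N b x) \<le> 112 * real N / R * J" for x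
  proof -
    \<comment> \<open>A factor 4 from the density of squarefree numbers and 2 from rounding; with
      the 14 of the large sieve this gives 112 = 8 * 14.\<close>
    have "R / 8 \<le> real (card {d \<in> {1..P}. squarefree d})"
      using card_squarefree_ge [of P] P by simp
    then have "R / 8 * cmod (trig_poly N b x) \<le> real (card {d \<in> {1..P}. squarefree d}) * cmod (trig_poly N b x)"
      by (intro mult_right_mono) auto
    also have "\<dots> \<le> 14 * real N * J"
      unfolding J_def using assms \<open>P ^ 4 \<le> N\<close> by (intro card_squarefree_mult_norm_trig_poly_le)
    finally show ?thesis
      using \<open>R \<ge> 1\<close> by (simp add: field_simps)
  qed
  then have "(\<Sum>n=1..N. (cmod (b n))\<^sup>2) \<le> 112 * real N / R * J * J"
    unfolding J_def by (rule sum_norm_squared_le)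
  also have "real N / R = real N powr (3/4)"
    using assms powr_diff [of "real N" 1 "1/4"] by (simp add: R_def)
  then have "112 * real N / R * J * J = 112 * real N powr (3/4) * J\<^sup>2"
    by (simp add: power2_eq_square flip: times_divide_eq_right)
  finally show ?thesis
    by (simp add: J_def)
qed

theorem theorem1:
  shows "\<exists>c::real. c > 0 \<and>
    (\<forall>N::nat. \<forall>b::nat \<Rightarrow> complex. N \<ge> 2 \<longrightarrow>
      (\<forall>n\<in>{1..N}. \<not> squarefree n \<longrightarrow> b n = 0) \<longrightarrow>
      integral {0..1} (\<lambda>\<alpha>::real. cmod (\<Sum>n=1..N. b n * ee (real n * \<alpha>)))
        \<ge> c / (real N powr (3/8) * sqrt (ln (real N))) * sqrt (\<Sum>n=1..N. (cmod (b n))\<^sup>2))"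
proof -
  \<comment> \<open>\<open>sqrt 112\<close> is the root of the constant in
    \<open>sum_norm_squared_le_L1_squared\<close>, and \<open>sqrt (ln 2)\<close> is at most
    \<open>sqrt (ln N)\<close> for N >= 2, which takes care of the logarithm in the claim.\<close>
  define c where "c = sqrt (ln 2) / sqrt 112"
  have "c > 0"
    by (simp add: c_def)
  moreover have "c / (real N powr (3/8) * sqrt (ln (real N))) * sqrt (\<Sum>n=1..N. (cmod (b n))\<^sup>2)
      \<le> integral {0..1} (\<lambda>\<alpha>::real. cmod (\<Sum>n=1..N. b n * ee (real n * \<alpha>)))"
    if N: "N \<ge> 2" and b: "\<forall>n\<in>{1..N}. \<not> squarefree n \<longrightarrow> b n = 0" for N b
  proof -
    define J where "J = integral {0..1} (\<lambda>t. cmod (trig_poly N b t))"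
    define S where "S = sqrt (\<Sum>n=1..N. (cmod (b n))\<^sup>2)"
    have "J \<ge> 0"
      unfolding J_def by (intro integral_nonneg integrable_continuous_real continuous_intros) auto
    have "S \<ge> 0"
      by (simp add: S_def sum_nonneg)
    have "sqrt (real N powr (3/4)) = real N powr (3/8)"
      using N by (simp add: powr_half_sqrt [symmetric] powr_powr)
    moreover have "S \<le> sqrt (112 * real N powr (3/4) * J\<^sup>2)"
      unfolding S_def J_def using N b by (intro real_sqrt_le_mono sum_norm_squared_le_L1_squared) auto
    ultimately have S: "S \<le> sqrt 112 * real N powr (3/8) * J"
      using \<open>J \<ge> 0\<close> by (simp add: real_sqrt_mult)
    have pos: "real N powr (3/8) > 0" "ln (real N) > 0"
      using N by auto
    have "c / (real N powr (3/8) * sqrt (ln (real N))) \<le> (1 / sqrt 112) / real N powr (3/8)"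
    proof -
      have "sqrt (ln 2) \<le> sqrt (ln (real N))"
        using N by simp
      then show ?thesis
        using pos by (simp add: c_def field_simps)
    qed
    then have "c / (real N powr (3/8) * sqrt (ln (real N))) * S \<le> (1 / sqrt 112) / real N powr (3/8) * S"
      using \<open>S \<ge> 0\<close> by (intro mult_right_mono)
    also have "\<dots> \<le> J"
      using S pos by (simp add: field_simps)
    finally show ?thesis
      by (simp add: S_def J_def trig_poly_def)
  qed
  ultimately show ?thesis
    by blast
qed

end
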